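(* If $\theta_i=0$ for all $i\in[N]$, then the function $\boldsymbol{\lambda}\mapsto c(\boldsymbol{\lambda})$ is convex and linear on $\Lambda$.
   Context: Fix an integer $N\ge 1$ and write $[N]=\{1,\dots,N\}$. Costs $c_{(i)}>0$ and $c_{(i,j)}>0$ ($i,j\in[N]$) are given with $c_{(i)}=c_{(i,i)}\le c_{(i,j)}=c_{(j,i)}$ for all $i,j\in[N]$. The parameters $\theta_i\ge 0$ ($i\in[N]$) are given. The domain is the box $\Lambda=[\underline{\boldsymbol{\lambda}},\overline{\boldsymbol{\lambda}}]=\{\boldsymbol{\lambda}\in\mathbb{R}^N:\underline{\lambda}_i\le\lambda_i\le\overline{\lambda}_i\ \forall i\}$ with $\underline{\lambda}_i>0$ for all $i$. For $\boldsymbol{\lambda}\in\Lambda$, $c(\boldsymbol{\lambda})$ is the optimal value of the linear program in variables $\boldsymbol{x}=(x_{i,j})_{i,j\in[N]}$, $\boldsymbol{y}=(y_i)_{i\in[N]}$: minimize $\sum_{i,j\in[N]}c_{(i,j)}x_{i,j}+\sum_{i\in[N]}c_{(i)}y_i$ subject to $\sum_{j\in[N]}x_{j,i}+\sum_{j\in[N]}x_{i,j}+y_i=\lambda_i$ for all $i\in[N]$; $\theta_i x_{i,j}\le\lambda_j y_i$ for all $i,j\in[N]$; $x_{i,j}\ge 0$ for all $i,j\in[N]$; $y_i\ge 0$ for all $i\in[N]$. *)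

theory Defs
  imports "HOL-Analysis.Analysis"
begin

text \<open>
  The index set \<open>[N]\<close> with \<open>N \<ge> 1\<close> is an arbitrary type \<open>'n\<close> of class \<open>finite\<close>. The cost
  \<open>c\<^sub>(\<^sub>i\<^sub>)\<close> is \<open>c1 $ i\<close>, the cost \<open>c\<^sub>(\<^sub>i\<^sub>,\<^sub>j\<^sub>)\<close> is \<open>c2 $ i $ j\<close>, and the variable \<open>x\<^sub>i\<^sub>,\<^sub>j\<close> is \<open>x $ i $ j\<close>.
\<close>

definition feasible ::
  "real ^ 'n \<Rightarrow> real ^ 'n \<Rightarrow> ((real ^ 'n ^ 'n) \<times> (real ^ 'n)) set" where
  "feasible \<theta> l = {(x, y).
     (\<forall>i. (\<Sum>j\<in>UNIV. x $ j $ i) + (\<Sum>j\<in>UNIV. x $ i $ j) + y $ i = l $ i) \<and>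
     (\<forall>i j. \<theta> $ i * x $ i $ j \<le> l $ j * y $ i) \<and>
     (\<forall>i j. 0 \<le> x $ i $ j) \<and>
     (\<forall>i. 0 \<le> y $ i)}"

definition total_cost ::
  "real ^ 'n \<Rightarrow> real ^ 'n ^ 'n \<Rightarrow> (real ^ 'n ^ 'n) \<times> (real ^ 'n) \<Rightarrow> real" where
  "total_cost c1 c2 = (\<lambda>(x, y).
     (\<Sum>i\<in>UNIV. \<Sum>j\<in>UNIV. c2 $ i $ j * x $ i $ j) + (\<Sum>i\<in>UNIV. c1 $ i * y $ i))"

definition opt_value ::
  "real ^ 'n \<Rightarrow> real ^ 'n ^ 'n \<Rightarrow> real ^ 'n \<Rightarrow> real ^ 'n \<Rightarrow> real" where
  "opt_value c1 c2 \<theta> l = (INF z \<in> feasible \<theta> l. total_cost c1 c2 z)"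

text \<open>
  For nonnegative \<open>l\<close> the feasible set is nonempty and compact, so the infimum over the reals
  is a minimum and never an unspecified value.
\<close>

lemma feasible_nonempty:
  fixes l :: "real ^ 'n"
  assumes "\<And>i. 0 \<le> l $ i"
  shows "feasible \<theta> l \<noteq> {}"
proof -
  have "(0, l) \<in> feasible \<theta> l"
    using assms by (simp add: feasible_def)
  then show ?thesis by blast
qed

lemma compact_feasible:
  fixes l :: "real ^ 'n"
  shows "compact (feasible \<theta> l)"
proof -
  have x_le: "x $ i $ j \<le> l $ i" and y_le: "y $ i \<le> l $ i"
    and nn: "0 \<le> x $ i $ j" "0 \<le> y $ i"
    if "(x, y) \<in> feasible \<theta> l" for x y i j
  proof -
    have eq: "(\<Sum>j\<in>UNIV. x $ j $ i) + (\<Sum>j\<in>UNIV. x $ i $ j) + y $ i = l $ i"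
      and x0: "\<And>i j. 0 \<le> x $ i $ j" and y0: "\<And>i. 0 \<le> y $ i"
      using that by (auto simp: feasible_def)
    have "0 \<le> (\<Sum>j\<in>UNIV. x $ j $ i)" "x $ i $ j \<le> (\<Sum>j\<in>UNIV. x $ i $ j)"
      by (simp add: sum_nonneg x0, rule member_le_sum) (simp_all add: x0)
    then show "x $ i $ j \<le> l $ i" "y $ i \<le> l $ i" "0 \<le> x $ i $ j" "0 \<le> y $ i"
      using eq x0[of i j] y0[of i] by linarith+
  qed
  have "feasible \<theta> l \<subseteq> {0..(\<chi> i j. l $ i)} \<times> {0..l}"
    by (rule subrelI) (simp add: less_eq_vec_def x_le y_le nn)
  then have "bounded (feasible \<theta> l)"
    by (rule bounded_subset[rotated]) (simp add: bounded_Times cbox_interval[symmetric])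
  moreover have "closed (feasible \<theta> l)"
    unfolding feasible_def case_prod_unfold
    by (intro closed_Collect_conj closed_Collect_all closed_Collect_eq closed_Collect_le
        continuous_intros)
  ultimately show ?thesis
    by (simp add: compact_eq_bounded_closed)
qed

lemma opt_value_attained:
  fixes l :: "real ^ 'n"
  assumes "\<And>i. 0 \<le> l $ i"
  shows "\<exists>z \<in> feasible \<theta> l. total_cost c1 c2 z = opt_value c1 c2 \<theta> l \<and>
           (\<forall>w \<in> feasible \<theta> l. total_cost c1 c2 z \<le> total_cost c1 c2 w)"
proof -
  have "continuous_on (feasible \<theta> l) (total_cost c1 c2)"
    unfolding total_cost_def case_prod_unfold by (intro continuous_intros)
  then obtain z where z: "z \<in> feasible \<theta> l"
    and le: "\<And>w. w \<in> feasible \<theta> l \<Longrightarrow> total_cost c1 c2 z \<le> total_cost c1 c2 w"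
    using continuous_attains_inf[OF compact_feasible feasible_nonempty[OF assms]] by metis
  have "opt_value c1 c2 \<theta> l = total_cost c1 c2 z"
    unfolding opt_value_def using z le by (intro cInf_eq_minimum) auto
  with z le show ?thesis by auto
qed

end

theory Submission
  imports Defs
begin

text \<open>
  For \<open>\<theta> = 0\<close>, a unit of \<open>x\<^sub>i\<^sub>,\<^sub>j\<close> serves one unit of \<open>i\<close> and one of \<open>j\<close> at cost at least
  \<open>(c\<^sub>(\<^sub>i\<^sub>) + c\<^sub>(\<^sub>j\<^sub>)) / 2\<close>, so every unit of \<open>i\<close> costs at least \<open>c\<^sub>(\<^sub>i\<^sub>) / 2\<close>. The diagonal solution
  \<open>x\<^sub>i\<^sub>,\<^sub>i = \<lambda>\<^sub>i / 2\<close> attains this bound, so the optimal value is \<open>\<Sum>\<^sub>i c\<^sub>(\<^sub>i\<^sub>) \<lambda>\<^sub>i / 2\<close>.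
\<close>

lemma total_cost_ge_half:
  fixes c1 :: "real ^ 'n" and c2 :: "real ^ 'n ^ 'n"
  assumes c1: "\<And>i. 0 \<le> c1 $ i"
    and le: "\<And>i j. c1 $ i \<le> c2 $ i $ j"
    and sym: "\<And>i j. c2 $ i $ j = c2 $ j $ i"
    and z: "z \<in> feasible \<theta> l"
  shows "(\<Sum>i\<in>UNIV. c1 $ i * l $ i / 2) \<le> total_cost c1 c2 z"
proof -
  obtain x y where [simp]: "z = (x, y)" by fastforce
  have eq: "l $ i = (\<Sum>j\<in>UNIV. x $ j $ i) + (\<Sum>j\<in>UNIV. x $ i $ j) + y $ i"
    and x: "0 \<le> x $ i $ j" and y: "0 \<le> y $ i" for i j
    using z by (auto simp: feasible_def)
  \<comment> \<open>Weak LP duality: \<open>c1 $ i / 2\<close> is the multiplier of the i-th balance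
    equation.\<close>
  have "c1 $ i * l $ i / 2 = (\<Sum>j\<in>UNIV. c1 $ i / 2 * x $ j $ i)
      + (\<Sum>j\<in>UNIV. c1 $ i / 2 * x $ i $ j) + c1 $ i / 2 * y $ i" for i
    unfolding eq[of i] sum_distrib_left[symmetric] by argo
  then have "(\<Sum>i\<in>UNIV. c1 $ i * l $ i / 2)
      = (\<Sum>i\<in>UNIV. \<Sum>j\<in>UNIV. c1 $ i / 2 * x $ j $ i)
        + (\<Sum>i\<in>UNIV. \<Sum>j\<in>UNIV. c1 $ i / 2 * x $ i $ j) + (\<Sum>i\<in>UNIV. c1 $ i / 2 * y $ i)"
    by (simp only: sum.distrib)
  \<comment> \<open>Exchanging the indices lets both double sums run over \<open>x $ i $ j\<close>,
    so their coefficients can be added.\<close>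
  also have "(\<Sum>i\<in>UNIV. \<Sum>j\<in>UNIV. c1 $ i / 2 * x $ j $ i)
      = (\<Sum>i\<in>UNIV. \<Sum>j\<in>UNIV. c1 $ j / 2 * x $ i $ j)"
    by (rule sum.swap)
  also have "\<dots> + (\<Sum>i\<in>UNIV. \<Sum>j\<in>UNIV. c1 $ i / 2 * x $ i $ j)
      = (\<Sum>i\<in>UNIV. \<Sum>j\<in>UNIV. (c1 $ j + c1 $ i) / 2 * x $ i $ j)"
    by (simp only: sum.distrib[symmetric]) (simp add: algebra_simps add_divide_distrib)
  also have "\<dots> \<le> (\<Sum>i\<in>UNIV. \<Sum>j\<in>UNIV. c2 $ i $ j * x $ i $ j)"
  proof (intro sum_mono mult_right_mono x)
    \<comment> \<open>By symmetry \<open>c2 $ i $ j\<close> bounds both \<open>c1 $ i\<close> and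
      \<open>c1 $ j\<close>, hence their mean.\<close>
    show "(c1 $ j + c1 $ i) / 2 \<le> c2 $ i $ j" for i j
      using le[of i j] le[of j i] sym[of i j] by simp
  qed
  also have "(\<Sum>i\<in>UNIV. c1 $ i / 2 * y $ i) \<le> (\<Sum>i\<in>UNIV. c1 $ i * y $ i)"
    by (intro sum_mono mult_right_mono y) (simp add: c1)
  finally show ?thesis by (simp add: total_cost_def)
qed

lemma opt_value_zero_theta:
  fixes c1 :: "real ^ 'n" and c2 :: "real ^ 'n ^ 'n"
  assumes c1: "\<And>i. 0 \<le> c1 $ i"
    and diag: "\<And>i. c1 $ i = c2 $ i $ i"
    and le: "\<And>i j. c1 $ i \<le> c2 $ i $ j"
    and sym: "\<And>i j. c2 $ i $ j = c2 $ j $ i"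
    and l: "\<And>i. 0 \<le> l $ i"
  shows "opt_value c1 c2 0 l = (\<Sum>i\<in>UNIV. c1 $ i * l $ i / 2)"
  unfolding opt_value_def
proof (rule cInf_eq_minimum)
  \<comment> \<open>The diagonal entry occurs in both the row sum and the column sum of the balance
    equation, hence the factor 1/2. Nothing is left for \<open>y\<close>.\<close>
  define x where "x = (\<chi> i j. if i = j then l $ i / 2 else 0)"
  have "(x, 0) \<in> feasible 0 l"
    by (simp add: x_def feasible_def l)
  moreover have "c2 $ i $ j * x $ i $ j = (if i = j then c1 $ i * l $ i / 2 else 0)" for i j
    by (simp add: x_def diag)
  then have "(\<Sum>i\<in>UNIV. c1 $ i * l $ i / 2) = total_cost c1 c2 (x, 0)"
    by (simp add: total_cost_def)
  ultimately show "(\<Sum>i\<in>UNIV. c1 $ i * l $ i / 2) \<in> total_cost c1 c2 ` feasible 0 l"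
    by (rule rev_image_eqI)
qed (auto intro: total_cost_ge_half[OF c1 le sym])

theorem proposition1:
  fixes c1 :: "real ^ 'n" and c2 :: "real ^ 'n ^ 'n"
    and \<theta> :: "real ^ 'n" and lo up :: "real ^ 'n"
  assumes "\<And>i. 0 < c1 $ i"
    and "\<And>i j. 0 < c2 $ i $ j"
    and "\<And>i. c1 $ i = c2 $ i $ i"
    and "\<And>i j. c1 $ i \<le> c2 $ i $ j"
    and "\<And>i j. c2 $ i $ j = c2 $ j $ i"
    and "\<And>i. 0 \<le> \<theta> $ i"
    and "\<And>i. 0 < lo $ i"
    and "\<And>i. \<theta> $ i = 0"
  shows "convex_on {lo..up} (opt_value c1 c2 \<theta>) \<and>
    (\<exists>f :: real ^ 'n \<Rightarrow> real. linear f \<and> (\<forall>l \<in> {lo..up}. opt_value c1 c2 \<theta> l = f l))"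
proof -
  define f :: "real ^ 'n \<Rightarrow> real" where "f l = (\<Sum>i\<in>UNIV. c1 $ i * l $ i / 2)" for l
  have f: "linear f"
    by (rule linearI)
      (simp_all add: f_def sum.distrib sum_distrib_left distrib_left add_divide_distrib mult.left_commute)
  have "\<theta> = 0"
    using assms(8) by (simp add: vec_eq_iff)
  have opt: "opt_value c1 c2 \<theta> l = f l" if "l \<in> {lo..up}" for l
    unfolding f_def \<open>\<theta> = 0\<close>
  proof (rule opt_value_zero_theta)
    \<comment> \<open>Positive lower bounds make the diagonal solution nonnegative at every point of
      the box.\<close>
    show "0 \<le> l $ i" for i
      using that assms(7)[of i] by (auto simp: less_eq_vec_def intro: order_trans less_imp_le)
  qed (use assms less_imp_le in blast)+
  have cvx: "convex {lo..up}"
    by (simp add: cbox_interval[symmetric] convex_box)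
  then have "convex_on {lo..up} f"
    by (simp add: convex_on_def linear_add[OF f] linear_scale[OF f])
  \<comment> \<open>The box contains all convex combinations of its points, so agreement with
    \<open>f\<close> on the box suffices to transfer convexity.\<close>
  then have "convex_on {lo..up} (opt_value c1 c2 \<theta>)"
    using opt cvx by (simp add: convex_on_def convex_def)
  with f opt show ?thesis by blast
qed

end
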